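(* The gapset filtrations of multiplicity $4$ are exactly the filtrations $F=F(\sigma,e)$ with $\sigma\in\mathfrak S_3$ and $e=(a,b,c)\in\mathbb N^3$ such that $a\ge 1$, subject to the following conditions (where $\sigma$ is written in window notation $(\sigma(1),\sigma(2),\sigma(3))$): $$\begin{array}{l|c|l} \sigma & F=F(\sigma,e) & \text{conditions on } a,b,c\\ \hline (1,2,3)&(123)^a(23)^b(3)^c& b\leq a,\ c\leq a \\ (1,3,2)&(123)^a(23)^b(2)^c& b+c\leq a\\ (2,1,3)&(123)^a(13)^b(3)^c& c\leq a\\ (2,3,1)&(123)^a(13)^b(1)^c& c\leq a+1\\ (3,1,2)&(123)^a(12)^b(2)^c& b+c\leq a+1,\ c\leq a+b\\ (3,2,1)&(123)^a(12)^b(1)^c& b\leq a+1,\ c\leq a+1 \end{array}$$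
   Context: Notation: $\mathbb N=\{0,1,2,\dots\}$, $\mathbb N_+=\{1,2,\dots\}$, $[a,b]$ denotes the integer interval $\{z\in\mathbb Z: a\le z\le b\}$, and $\mathfrak S_{m-1}$ is the symmetric group on $[1,m-1]$. A gapset is a finite set $G\subset\mathbb N_+$ such that for all $z\in G$, if $z=x+y$ with $x,y\in\mathbb N_+$, then $x\in G$ or $y\in G$ (equivalently, $\mathbb N\setminus G$ is a numerical semigroup). Its multiplicity is the smallest integer $m\ge 1$ with $m\notin G$; its conductor is $c=1+\max(G)$ if $G\ne\emptyset$ and $c=0$ otherwise; its depth is $q=\lceil c/m\rceil$. For a gapset $G$ of multiplicity $m$ and depth $q$, put $G_i=G\cap[im+1,(i+1)m-1]$ and $F_i=-im+G_i=\{x-im: x\in G_i\}$ for $0\le i\le q-1$. The gapset filtration associated to $G$ is the finite sequence $(F_0,F_1,\dots,F_{q-1})$; it satisfies $[1,m-1]=F_0\supseteq F_1\supseteq\dots\supseteq F_{q-1}$. A gapset filtration of multiplicity $m$ is a sequence arising in this way from a gapset of multiplicity $m$. For $\sigma\in\mathfrak S_{m-1}$ and $e=(e_0,\dots,e_{m-2})\in\mathbb N^{m-1}$ with $e_0\ge 1$, $F(\sigma,e)$ denotes the finite sequence of sets $$(\underbrace{F'_0,\dots,F'_0}_{e_0},\underbrace{F'_1,\dots,F'_1}_{e_1},\dots,\underbrace{F'_{m-2},\dots,F'_{m-2}}_{e_{m-2}}),$$ where $F'_0=[1,m-1]$ and $F'_i=F'_{i-1}\setminus\{\sigma(i)\}$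 for $1\le i\le m-2$. In the compact notation of the table ($m=4$), $(123)^a(23)^b(3)^c$ denotes the sequence consisting of $a$ copies of $\{1,2,3\}$, followed by $b$ copies of $\{2,3\}$, followed by $c$ copies of $\{3\}$, and similarly for the other rows. *)

theory Defs
  imports Complex_Main "HOL-Combinatorics.Permutations"
begin

definition gapset :: "nat set \<Rightarrow> bool" where
  "gapset G \<longleftrightarrow> finite G \<and> G \<subseteq> {1..} \<and>
     (\<forall>z\<in>G. \<forall>x\<ge>1. \<forall>y\<ge>1. z = x + y \<longrightarrow> x \<in> G \<or> y \<in> G)"

definition multiplicity :: "nat set \<Rightarrow> nat" where
  "multiplicity G = (LEAST m. m \<ge> 1 \<and> m \<notin> G)"

definition conductor :: "nat set \<Rightarrow> nat" where
  "conductor G = (if G = {} then 0 else 1 + Max G)"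

definition depth :: "nat set \<Rightarrow> nat" where
  "depth G = nat \<lceil>real (conductor G) / real (multiplicity G)\<rceil>"

definition gap_block :: "nat set \<Rightarrow> nat \<Rightarrow> nat set" where
  "gap_block G i = G \<inter> {i * multiplicity G + 1..(i + 1) * multiplicity G - 1}"

(* The natural subtraction never truncates: every x in the block exceeds i m. *)
definition filtration_part :: "nat set \<Rightarrow> nat \<Rightarrow> nat set" where
  "filtration_part G i = (\<lambda>x. x - i * multiplicity G) ` gap_block G i"

definition gapset_filtration_of :: "nat set \<Rightarrow> nat set list" where
  "gapset_filtration_of G = map (filtration_part G) [0..<depth G]"

definition gapset_filtration :: "nat \<Rightarrow> nat set list \<Rightarrow> bool" where
  "gapset_filtration m F \<longleftrightarrow>
     (\<exists>G. gapset G \<and> multiplicity G = m \<and> F = gapset_filtration_of G)"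

fun chain_set :: "nat \<Rightarrow> (nat \<Rightarrow> nat) \<Rightarrow> nat \<Rightarrow> nat set" where
  "chain_set m \<sigma> 0 = {1..m - 1}"
| "chain_set m \<sigma> (Suc i) = chain_set m \<sigma> i - {\<sigma> (Suc i)}"

(* F(sigma, e) for sigma in the symmetric group on {1..m-1}; the exponent vector
   (e_0, ..., e_(m-2)) is given as a list of length m - 1. *)
definition perm_filtration :: "nat \<Rightarrow> (nat \<Rightarrow> nat) \<Rightarrow> nat list \<Rightarrow> nat set list" where
  "perm_filtration m \<sigma> e =
     concat (map (\<lambda>i. replicate (e ! i) (chain_set m \<sigma> i)) [0..<m - 1])"

definition window :: "nat \<Rightarrow> (nat \<Rightarrow> nat) \<Rightarrow> nat list" where
  "window n \<sigma> = map \<sigma> [1..<n + 1]"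

end

theory Submission
  imports Defs
begin

text \<open>
  A gapset of multiplicity \<open>m\<close> contains no multiple of \<open>m\<close>, and since \<open>m\<close> itself is not a gap,
  \<open>x + m\<close> being a gap forces \<open>x\<close> to be one. Within each residue class \<open>r\<close> it is
  therefore an initial segment \<open>r, m + r, \<dots>, (k r - 1) * m + r\<close>, so the gapset is determined by
  its Kunz coordinates \<open>k 1, \<dots>, k (m - 1) \<ge> 1\<close>. The gapset condition only has to be tested at the
  smallest non-gaps \<open>k r * m + r\<close> of the classes, because adding multiples of \<open>m\<close> preserves
  non-gaps; this yields the Kunz inequalities (lemma \<open>gapset_kunz_gaps_iff\<close>). For \<open>m = 4\<close> they read
  \<open>k 2 \<le> 2 k 1\<close>, \<open>k 3 \<le> k 1 + k 2\<close>, \<open>k 1 \<le> k 2 + k 3 + 1\<close> and \<open>k 2 \<le> 2 k 3 + 1\<close>.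

  In these coordinates the gapset filtration is the sequence of superlevel sets
  \<open>{r. i < k r}\<close> for \<open>i < Max k\<close> (lemma \<open>gapset_filtration_iff_kunz\<close>). On the other hand
  \<open>F(\<sigma>, e)\<close> is the same kind of sequence: the element \<open>\<sigma>(j)\<close> survives
  exactly \<open>e\<^sub>0 + \<dots> + e\<^bsub>j-1\<^esub>\<close> steps, so this partial sum is its coordinate
  (lemma \<open>perm_filtration_eq_superlevel\<close>). Thus \<open>\<sigma>\<close> lists the
  residues by nondecreasing coordinate and \<open>e\<close> records the successive differences. For each of the
  six permutations, substituting \<open>a\<close>, \<open>a + b\<close>, \<open>a + b + c\<close> for the sorted coordinates in the four
  Kunz inequalities leaves the conditions in the corresponding row of the table.
\<close>

section \<open>Kunz coordinates of a gapset\<close>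

definition kunz_gaps :: "nat \<Rightarrow> (nat \<Rightarrow> nat) \<Rightarrow> nat set" where
  "kunz_gaps m k = {x. x mod m \<noteq> 0 \<and> x div m < k (x mod m)}"

definition kunz_inequalities :: "nat \<Rightarrow> (nat \<Rightarrow> nat) \<Rightarrow> bool" where
  "kunz_inequalities m k \<longleftrightarrow>
     (\<forall>r\<in>{1..<m}. \<forall>s\<in>{1..<m}.
        (r + s < m \<longrightarrow> k (r + s) \<le> k r + k s) \<and>
        (r + s > m \<longrightarrow> k (r + s - m) \<le> k r + k s + 1))"

lemma mem_kunz_gaps [simp]:
  assumes "r < m"
  shows "i * m + r \<in> kunz_gaps m k \<longleftrightarrow> r \<noteq> 0 \<and> i < k r"
  using assms by (auto simp: kunz_gaps_def)

lemma kunz_gaps_subset: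
  assumes "m \<ge> 1"
  shows "kunz_gaps m k \<subseteq> (\<Union>r\<in>{1..<m}. (\<lambda>i. i * m + r) ` {..<k r})"
proof
  fix x assume "x \<in> kunz_gaps m k"
  hence "x mod m \<in> {1..<m}" "x \<in> (\<lambda>i. i * m + x mod m) ` {..<k (x mod m)}"
    using assms by (auto simp: kunz_gaps_def intro!: image_eqI[where x = "x div m"])
  thus "x \<in> (\<Union>r\<in>{1..<m}. (\<lambda>i. i * m + r) ` {..<k r})" by blast
qed

lemma finite_kunz_gaps: "m \<ge> 1 \<Longrightarrow> finite (kunz_gaps m k)"
  by (rule finite_subset[OF kunz_gaps_subset]) auto

text \<open>Necessity comes from the smallest non-gaps of two classes: their sum is again a non-gap.
  Sufficiency compares quotients by \<open>m\<close>; when \<open>r + s > m\<close> the carry in the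
  remainders is the extra \<open>1\<close> in the second family of inequalities.\<close>

lemma gapset_kunz_gaps_iff:
  assumes "m \<ge> 1"
  shows "gapset (kunz_gaps m k) \<longleftrightarrow> kunz_inequalities m k"
proof
  assume G: "gapset (kunz_gaps m k)"
  have nongap: "(k r * m + r) + (k s * m + s) \<notin> kunz_gaps m k"
    if "r \<in> {1..<m}" "s \<in> {1..<m}" for r s
  proof
    assume "(k r * m + r) + (k s * m + s) \<in> kunz_gaps m k"
    moreover have "k r * m + r \<ge> 1" "k s * m + s \<ge> 1" using that by auto
    ultimately have "k r * m + r \<in> kunz_gaps m k \<or> k s * m + s \<in> kunz_gaps m k"
      using G unfolding gapset_def by blast
    thus False using that by auto
  qed
  show "kunz_inequalities m k"
    unfolding kunz_inequalities_def
  proof (intro ballI conjI impI)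
    fix r s assume rs: "r \<in> {1..<m}" "s \<in> {1..<m}"
    {
      assume lt: "r + s < m"
      have "(k r * m + r) + (k s * m + s) = (k r + k s) * m + (r + s)"
        by (simp add: algebra_simps)
      hence "(k r + k s) * m + (r + s) \<notin> kunz_gaps m k" using nongap[OF rs] by metis
      thus "k (r + s) \<le> k r + k s"
        using rs by (simp only: mem_kunz_gaps[OF lt]) auto
    next
      assume gt: "r + s > m"
      hence "(k r * m + r) + (k s * m + s) = (k r + k s + 1) * m + (r + s - m)"
        by (simp add: algebra_simps)
      moreover have "r + s - m < m" using rs by auto
      ultimately have "(k r + k s + 1) * m + (r + s - m) \<notin> kunz_gaps m k" "r + s - m < m"
        using nongap[OF rs] by metis+
      thus "k (r + s - m) \<le> k r + k s + 1"
        using gt by (simp only: mem_kunz_gaps) auto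
    }
  qed
next
  assume K: "kunz_inequalities m k"
  have "x \<in> kunz_gaps m k \<or> y \<in> kunz_gaps m k" if xy: "x + y \<in> kunz_gaps m k" for x y
  proof (rule ccontr)
    assume neg: "\<not> (x \<in> kunz_gaps m k \<or> y \<in> kunz_gaps m k)"
    define r s i j where "r = x mod m" "s = y mod m" "i = x div m" "j = y div m"
    have x: "x = i * m + r" and y: "y = j * m + s" and rs: "r < m" "s < m"
      using assms by (auto simp: r_s_i_j_def)
    have ri: "r = 0 \<or> k r \<le> i" and sj: "s = 0 \<or> k s \<le> j"
      using neg rs by (auto simp: x y)
    show False
    proof (cases "r + s < m")
      case True
      have "x + y = (i + j) * m + (r + s)" by (simp add: x y algebra_simps)
      hence *: "r + s \<noteq> 0" "i + j < k (r + s)" using xy mem_kunz_gaps[OF True] by metis+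
      show False
      proof (cases "r = 0 \<or> s = 0")
        case True thus False using * ri sj by auto
      next
        case False
        hence "k (r + s) \<le> k r + k s"
          using K rs True unfolding kunz_inequalities_def by auto
        thus False using * ri sj False by linarith
      qed
    next
      case False
      have eq: "x + y = (i + j + 1) * m + (r + s - m)" using False
        by (simp add: x y algebra_simps)
      have lt: "r + s - m < m" using rs by auto
      have *: "r + s - m \<noteq> 0" "i + j + 1 < k (r + s - m)"
        using xy eq mem_kunz_gaps[OF lt] by metis+
      have "k (r + s - m) \<le> k r + k s + 1"
        using K rs * unfolding kunz_inequalities_def by auto
      thus False using * ri sj rs by linarith
    qed
  qed
  moreover have "kunz_gaps m k \<subseteq> {1..}"
    by (auto simp: kunz_gaps_def Suc_le_eq intro!: gr0I)
  ultimately show "gapset (kunz_gaps m k)"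
    unfolding gapset_def using finite_kunz_gaps[OF assms] by blast
qed

lemma multiplicity_kunz_gaps:
  assumes "m \<ge> 1" and "\<And>r. r \<in> {1..<m} \<Longrightarrow> k r \<ge> 1"
  shows "multiplicity (kunz_gaps m k) = m"
  unfolding multiplicity_def
proof (rule Least_equality)
  show "m \<ge> 1 \<and> m \<notin> kunz_gaps m k" using assms by (simp add: kunz_gaps_def)
next
  fix y assume y: "y \<ge> 1 \<and> y \<notin> kunz_gaps m k"
  show "m \<le> y"
  proof (rule ccontr)
    assume "\<not> m \<le> y"
    hence "y \<in> {1..<m}" using y by auto
    thus False using y assms(2)[of y] by (auto simp: kunz_gaps_def)
  qed
qed

text \<open>This is the gapset condition for the gap \<open>x + m\<close>, whose summand \<open>m\<close> is not a gap; it makes each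
  residue class an initial segment.\<close>

lemma gapset_descend:
  assumes "gapset G" "m \<ge> 1" "m \<notin> G" "x \<ge> 1" "x + m \<in> G"
  shows "x \<in> G"
  using assms unfolding gapset_def by blast

lemma gapset_descend_mult:
  assumes "gapset G" "m \<ge> 1" "m \<notin> G" "x \<ge> 1"
  shows "x + j * m \<in> G \<Longrightarrow> x \<in> G"
proof (induction j)
  case (Suc j)
  have "(x + j * m) + m \<in> G" using Suc.prems by (simp add: algebra_simps)
  hence "x + j * m \<in> G" using gapset_descend[OF assms(1-3)] assms(4) by simp
  thus ?case by (rule Suc.IH)
qed simp

text \<open>The coordinate of the class \<open>r\<close> is the quotient of its smallest non-gap, which exists because
  a gapset is finite.\<close>

lemma gapset_eq_kunz_gaps:
  assumes G: "gapset G" and m: "multiplicity G = m"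
  obtains k where "G = kunz_gaps m k" "\<And>r. r \<in> {1..<m} \<Longrightarrow> k r \<ge> 1" "m \<ge> 1"
proof -
  have fin: "finite G" and "0 \<notin> G" using G by (auto simp: gapset_def)
  obtain y where "y \<notin> insert 0 G" using fin ex_new_if_finite[of "insert 0 G"] by auto
  hence "y \<ge> 1 \<and> y \<notin> G" by auto
  hence "m \<ge> 1 \<and> m \<notin> G" unfolding m[symmetric] multiplicity_def by (rule LeastI)
  hence m1: "m \<ge> 1" "m \<notin> G" by auto
  have small: "r \<in> G" if "r \<in> {1..<m}" for r
    using that not_less_Least[of r "\<lambda>m. m \<ge> 1 \<and> m \<notin> G"]
    unfolding m[symmetric] multiplicity_def by auto
  define k where "k r = (LEAST i. i * m + r \<notin> G)" for r
  have ex: "\<exists>i. i * m + r \<notin> G" for r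
  proof (rule ccontr)
    assume "\<not> (\<exists>i. i * m + r \<notin> G)"
    hence "(\<lambda>i. i * m + r) ` UNIV \<subseteq> G" by auto
    moreover have "inj (\<lambda>i. i * m + r)" using m1 by (auto simp: inj_on_def)
    ultimately show False using fin finite_subset finite_imageD infinite_UNIV_nat by metis
  qed
  have mem: "i * m + r \<in> G \<longleftrightarrow> i < k r" if r: "r \<in> {1..<m}" for i r
  proof
    show "i < k r \<Longrightarrow> i * m + r \<in> G" unfolding k_def using not_less_Least by blast
  next
    assume i: "i * m + r \<in> G"
    have kr: "k r * m + r \<notin> G" unfolding k_def using LeastI_ex[OF ex] .
    show "i < k r"
    proof (rule ccontr)
      assume "\<not> i < k r"
      then obtain j where "i = k r + j" using le_Suc_ex not_less by blast
      hence "(k r * m + r) + j * m \<in> G" using i by (simp add: algebra_simps)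
      hence "k r * m + r \<in> G" by (rule gapset_descend_mult[OF G m1, rotated]) (use r in auto)
      thus False using kr by simp
    qed
  qed
  have "x \<in> G \<longleftrightarrow> x \<in> kunz_gaps m k" for x
  proof (cases "x mod m = 0")
    case True
    then obtain i where x: "x = m * i" by auto
    have "x \<notin> G"
    proof (cases i)
      case 0 thus ?thesis using x \<open>0 \<notin> G\<close> by simp
    next
      case (Suc j)
      hence "x = m + j * m" using x by (simp add: algebra_simps)
      thus ?thesis using gapset_descend_mult[OF G m1 m1(1), of j] m1 by auto
    qed
    thus ?thesis using True by (simp add: kunz_gaps_def)
  next
    case False
    hence "x mod m \<in> {1..<m}" using m1 by auto
    from mem[OF this, of "x div m"] show ?thesis using False by (simp add: kunz_gaps_def)
  qed
  moreover have "k r \<ge> 1" if "r \<in> {1..<m}" for r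
    using mem[OF that, of 0] small[OF that] by simp
  ultimately show thesis using that m1 by blast
qed

section \<open>Filtrations as superlevel sets\<close>

definition superlevel :: "nat \<Rightarrow> (nat \<Rightarrow> nat) \<Rightarrow> nat \<Rightarrow> nat set" where
  "superlevel m k i = {r\<in>{1..<m}. i < k r}"

lemma filtration_part_kunz_gaps:
  assumes "multiplicity (kunz_gaps m k) = m"
  shows "filtration_part (kunz_gaps m k) i = superlevel m k i"
proof (intro equalityI subsetI)
  fix r assume "r \<in> filtration_part (kunz_gaps m k) i"
  then obtain x where x: "x \<in> kunz_gaps m k" "i * m + 1 \<le> x" "x \<le> (i + 1) * m - 1"
    "r = x - i * m"
    unfolding filtration_part_def gap_block_def assms by auto
  hence "x = i * m + r" "r \<ge> 1" "r < m" by (auto simp: algebra_simps)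
  thus "r \<in> superlevel m k i" using x(1) by (auto simp: superlevel_def)
next
  fix r assume r: "r \<in> superlevel m k i"
  hence "i * m + r \<in> gap_block (kunz_gaps m k) i"
    unfolding gap_block_def assms by (auto simp: superlevel_def)
  thus "r \<in> filtration_part (kunz_gaps m k) i"
    unfolding filtration_part_def assms by (force intro: image_eqI[where x = "i * m + r"])
qed

text \<open>The largest gap lies in the last nonempty block, hence is \<open>(K - 1) * m + r\<close> with \<open>0 < r < m\<close> and
  \<open>K\<close> the largest coordinate. The conductor then lies strictly above \<open>(K - 1) * m\<close> and does not
  exceed \<open>K * m\<close>.\<close>

lemma depth_kunz_gaps:
  assumes m: "m \<ge> 2" and k: "\<And>r. r \<in> {1..<m} \<Longrightarrow> k r \<ge> 1"
  shows "depth (kunz_gaps m k) = Max (k ` {1..<m})"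
proof -
  define K where "K = Max (k ` {1..<m})"
  let ?G = "kunz_gaps m k"
  have "K \<in> k ` {1..<m}" unfolding K_def using m by (intro Max_in) auto
  then obtain r where r: "r \<in> {1..<m}" "K = k r" by auto
  have K1: "K \<ge> 1" using r k by auto
  have fin: "finite ?G" using m by (intro finite_kunz_gaps) auto
  have memr: "(K - 1) * m + r \<in> ?G" using r K1 by auto
  have lower: "(K - 1) * m + r \<le> Max ?G" using Max_ge[OF fin memr] .
  have "Max ?G \<in> ?G" using fin memr by (intro Max_in) auto
  hence "Max ?G mod m \<in> {1..<m}" "Max ?G div m < k (Max ?G mod m)"
    using m by (auto simp: kunz_gaps_def)
  moreover from this have "k (Max ?G mod m) \<le> K" unfolding K_def by (intro Max_ge) auto
  ultimately have "Max ?G div m < K" by linarith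
  hence upper: "Max ?G < K * m" using m by (simp add: div_less_iff_less_mult)
  have c: "conductor ?G = 1 + Max ?G" using memr by (auto simp: conductor_def)
  have "\<lceil>real (conductor ?G) / real m\<rceil> = int K"
  proof (rule ceiling_unique)
    have "real ((K - 1) * m) < real (conductor ?G)"
      using lower c by (subst of_nat_less_iff) linarith
    hence "(real K - 1) * real m < real (conductor ?G)"
      using K1 by (simp add: of_nat_diff)
    thus "real_of_int (int K) - 1 < real (conductor ?G) / real m"
      using m by (simp add: pos_less_divide_eq)
    have "real (conductor ?G) \<le> real (K * m)"
      using upper c by (subst of_nat_le_iff) linarith
    thus "real (conductor ?G) / real m \<le> real_of_int (int K)"
      using m by (simp add: pos_divide_le_eq)
  qed
  moreover have "multiplicity ?G = m" using m k by (intro multiplicity_kunz_gaps) auto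
  ultimately show ?thesis by (simp add: depth_def K_def)
qed

lemma gapset_filtration_iff_kunz:
  assumes "m \<ge> 2"
  shows "gapset_filtration m F \<longleftrightarrow>
    (\<exists>k. (\<forall>r\<in>{1..<m}. k r \<ge> 1) \<and> kunz_inequalities m k \<and>
         F = map (superlevel m k) [0..<Max (k ` {1..<m})])"
proof -
  have filt: "gapset_filtration_of (kunz_gaps m k) =
      map (superlevel m k) [0..<Max (k ` {1..<m})]"
    and mult: "multiplicity (kunz_gaps m k) = m"
    if "\<forall>r\<in>{1..<m}. k r \<ge> 1" for k
  proof -
    show mult: "multiplicity (kunz_gaps m k) = m"
      using that assms by (intro multiplicity_kunz_gaps) auto
    show "gapset_filtration_of (kunz_gaps m k) =
        map (superlevel m k) [0..<Max (k ` {1..<m})]"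
      using depth_kunz_gaps[of m k] that assms
      by (simp add: gapset_filtration_of_def filtration_part_kunz_gaps[OF mult] cong: map_cong)
  qed
  have m1: "m \<ge> 1" using assms by simp
  show ?thesis
  proof
    assume "gapset_filtration m F"
    then obtain G where G: "gapset G" "multiplicity G = m" "F = gapset_filtration_of G"
      unfolding gapset_filtration_def by blast
    obtain k where k: "G = kunz_gaps m k" "\<And>r. r \<in> {1..<m} \<Longrightarrow> k r \<ge> 1"
      using gapset_eq_kunz_gaps[OF G(1,2)] by metis
    with G filt[of k] gapset_kunz_gaps_iff[OF m1, of k]
    show "\<exists>k. (\<forall>r\<in>{1..<m}. k r \<ge> 1) \<and> kunz_inequalities m k \<and>
         F = map (superlevel m k) [0..<Max (k ` {1..<m})]"
      by (intro exI[of _ k]) auto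
  next
    assume "\<exists>k. (\<forall>r\<in>{1..<m}. k r \<ge> 1) \<and> kunz_inequalities m k \<and>
         F = map (superlevel m k) [0..<Max (k ` {1..<m})]"
    thus "gapset_filtration m F"
      unfolding gapset_filtration_def using filt mult gapset_kunz_gaps_iff[OF m1] by metis
  qed
qed

lemma chain_set_eq: "chain_set m \<sigma> i = {1..m - 1} - \<sigma> ` {1..i}"
  by (induction i) (auto simp: atLeastAtMostSuc_conv)

text \<open>The element \<open>\<sigma>(j)\<close> is removed when passing to the \<open>j\<close>-th set of the chain, that is, after
  \<open>e\<^sub>0 + \<dots> + e\<^bsub>j-1\<^esub>\<close> entries of the filtration.\<close>

lemma perm_filtration_eq_superlevel:
  assumes \<sigma>: "\<sigma> permutes {1..m - 1}"
    and k: "\<And>j. j \<in> {1..<m} \<Longrightarrow> k (\<sigma> j) = (\<Sum>l<j. e ! l)"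
  shows "perm_filtration m \<sigma> e = map (superlevel m k) [0..<\<Sum>l<m - 1. e ! l]"
proof -
  define S where "S j = (\<Sum>l<j. e ! l)" for j
  have S_mono: "S i \<le> S j" if "i \<le> j" for i j
    unfolding S_def using that by (intro sum_mono2) auto
  have range: "{1..m - 1} = {1..<m}" by auto
  have surj: "\<sigma> ` {1..<m} = {1..<m}" using permutes_image[OF \<sigma>] unfolding range .
  have level: "superlevel m k t = chain_set m \<sigma> i"
    if i: "i < m - 1" and t: "S i \<le> t" "t < S (Suc i)" for i t
  proof -
    have "r \<in> superlevel m k t \<longleftrightarrow> r \<in> chain_set m \<sigma> i" if "r \<in> {1..<m}" for r
    proof -
      have "r \<in> \<sigma> ` {1..<m}" using that by (simp only: surj)
      then obtain j where j: "j \<in> {1..<m}" "r = \<sigma> j" by (elim imageE)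
      have "t < k r \<longleftrightarrow> i < j"
        using t S_mono[of j i] S_mono[of "Suc i" j] k[OF j(1)] j(2)
        unfolding S_def[symmetric] by (cases "i < j") auto
      moreover have "r \<in> \<sigma> ` {1..i} \<longleftrightarrow> j \<le> i"
        using j by (auto simp: inj_image_mem_iff[OF permutes_inj[OF \<sigma>]])
      ultimately show ?thesis
        using that by (auto simp: superlevel_def chain_set_eq)
    qed
    thus ?thesis by (auto simp: superlevel_def chain_set_eq)
  qed
  have "concat (map (\<lambda>i. replicate (e ! i) (chain_set m \<sigma> i)) [0..<n]) =
      map (superlevel m k) [0..<S n]" if "n \<le> m - 1" for n
    using that
  proof (induction n)
    case 0
    thus ?case by (simp add: S_def)
  next
    case (Suc n)
    have S_Suc: "S (Suc n) = S n + e ! n" by (simp add: S_def)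
    have "map (superlevel m k) [S n..<S n + e ! n] = replicate (e ! n) (chain_set m \<sigma> n)"
      using level[of n] Suc.prems by (intro nth_equalityI) (auto simp: S_Suc)
    moreover have "[0..<S (Suc n)] = [0..<S n] @ [S n..<S n + e ! n]"
      unfolding S_Suc by (rule upt_add_eq_append) simp
    ultimately show ?case using Suc by simp
  qed
  from this[of "m - 1"] show ?thesis unfolding perm_filtration_def S_def by simp
qed

text \<open>A permutation listing the residues by nondecreasing coordinate is read off from the sorted
  list \<open>sort_key k [1..<n + 1]\<close>.\<close>

lemma ex_sorting_permutation:
  fixes k :: "nat \<Rightarrow> 'a :: linorder"
  shows "\<exists>\<sigma>. \<sigma> permutes {1..n} \<and> (\<forall>i j. 1 \<le> i \<and> i \<le> j \<and> j \<le> n \<longrightarrow> k (\<sigma> i) \<le> k (\<sigma> j))"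
proof -
  define xs where "xs = sort_key k [1..<n + 1]"
  have xs: "length xs = n" "distinct xs" "set xs = {1..n}" "sorted (map k xs)"
    by (auto simp: xs_def)
  define \<sigma> where "\<sigma> i = (if i \<in> {1..n} then xs ! (i - 1) else i)" for i
  have "bij_betw (\<lambda>i. i - 1) {1..n} {..<n}"
    by (rule bij_betw_byWitness[where f' = Suc]) auto
  moreover have "bij_betw ((!) xs) {..<n} {1..n}"
    using bij_betw_nth[OF xs(2)] xs by simp
  ultimately have "bij_betw ((!) xs \<circ> (\<lambda>i. i - 1)) {1..n} {1..n}"
    by (rule bij_betw_trans)
  hence "bij_betw \<sigma> {1..n} {1..n}"
    by (rule bij_betw_cong[THEN iffD1, rotated]) (auto simp: \<sigma>_def)
  hence "\<sigma> permutes {1..n}" by (rule bij_imp_permutes) (auto simp: \<sigma>_def)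
  moreover have "k (\<sigma> i) \<le> k (\<sigma> j)" if "1 \<le> i" "i \<le> j" "j \<le> n" for i j
    using that sorted_nth_mono[OF xs(4), of "i - 1" "j - 1"] xs(1) by (auto simp: \<sigma>_def)
  ultimately show ?thesis by blast
qed

section \<open>Multiplicity four\<close>

lemma residues_4: "{1..<4::nat} = {1, 2, 3}"
  by auto

lemma kunz_inequalities_4:
  "kunz_inequalities 4 k \<longleftrightarrow>
     k 2 \<le> 2 * k 1 \<and> k 3 \<le> k 1 + k 2 \<and> k 1 \<le> k 2 + k 3 + 1 \<and> k 2 \<le> 2 * k 3 + 1"
  unfolding kunz_inequalities_def residues_4 by (auto simp: numeral_eq_Suc add.commute)

lemma window_3: "window 3 \<sigma> = [\<sigma> 1, \<sigma> 2, \<sigma> 3]"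
  by (simp add: window_def upt_rec numeral_eq_Suc)

lemma permutes_3_cases:
  fixes \<sigma> :: "nat \<Rightarrow> nat"
  assumes "\<sigma> permutes {1..3}"
  shows "(\<sigma> 1, \<sigma> 2, \<sigma> 3) \<in>
    {(1, 2, 3), (1, 3, 2), (2, 1, 3), (2, 3, 1), (3, 1, 2), (3, 2, 1)}"
proof -
  have "\<sigma> i \<in> {1, 2, 3}" if "i \<in> {1, 2, 3}" for i
    using permutes_in_image[OF assms, of i] that by auto
  hence "\<sigma> 1 \<in> {1, 2, 3}" "\<sigma> 2 \<in> {1, 2, 3}" "\<sigma> 3 \<in> {1, 2, 3}" by blast+
  moreover have "\<sigma> 1 \<noteq> \<sigma> 2" "\<sigma> 1 \<noteq> \<sigma> 3" "\<sigma> 2 \<noteq> \<sigma> 3"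
    using inj_eq[OF permutes_inj[OF assms]] by auto
  ultimately show ?thesis by - (elim insertE emptyE; simp)
qed

definition table_condition :: "(nat \<Rightarrow> nat) \<Rightarrow> nat \<Rightarrow> nat \<Rightarrow> nat \<Rightarrow> bool" where
  "table_condition \<sigma> a b c \<longleftrightarrow>
     window 3 \<sigma> = [1, 2, 3] \<and> b \<le> a \<and> c \<le> a \<or>
     window 3 \<sigma> = [1, 3, 2] \<and> b + c \<le> a \<or>
     window 3 \<sigma> = [2, 1, 3] \<and> c \<le> a \<or>
     window 3 \<sigma> = [2, 3, 1] \<and> c \<le> a + 1 \<or>
     window 3 \<sigma> = [3, 1, 2] \<and> b + c \<le> a + 1 \<and> c \<le> a + b \<or>
     window 3 \<sigma> = [3, 2, 1] \<and> b \<le> a + 1 \<and> c \<le> a + 1"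

text \<open>An inequality holds automatically when its right-hand side contains a coordinate that
  \<open>\<sigma>\<close> lists after the one on the left. The others become the entries of the table; for
  \<open>\<sigma> = (1, 3, 2)\<close> the single entry \<open>b + c \<le> a\<close>, that is \<open>k 2 \<le> 2 k 1\<close>, stands for two of them,
  as it implies \<open>k 2 \<le> 2 k 3 + 1\<close> by \<open>k 1 \<le> k 3\<close>.\<close>

lemma kunz_inequalities_4_iff_table:
  assumes "\<sigma> permutes {1..3}"
    and "k (\<sigma> 1) = a" "k (\<sigma> 2) = a + b" "k (\<sigma> 3) = a + b + c"
  shows "kunz_inequalities 4 k \<longleftrightarrow> table_condition \<sigma> a b c"
  using permutes_3_cases[OF assms(1)] assms(2-)
  unfolding kunz_inequalities_4 table_condition_def window_3
  by - (elim insertE emptyE; simp; linarith)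

lemma perm_filtration_4_eq_superlevel:
  assumes \<sigma>: "\<sigma> permutes {1..3}"
    and k: "k (\<sigma> 1) = a" "k (\<sigma> 2) = a + b" "k (\<sigma> 3) = a + b + c"
  shows "perm_filtration 4 \<sigma> [a, b, c] = map (superlevel 4 k) [0..<Max (k ` {1..<4})]"
proof -
  have sums: "(\<Sum>l<1. [a, b, c] ! l) = a" "(\<Sum>l<2. [a, b, c] ! l) = a + b"
    "(\<Sum>l<3. [a, b, c] ! l) = a + b + c"
    by (simp_all add: numeral_eq_Suc)
  have "perm_filtration 4 \<sigma> [a, b, c] = map (superlevel 4 k) [0..<\<Sum>l<4 - 1. [a, b, c] ! l]"
  proof (rule perm_filtration_eq_superlevel)
    show "\<sigma> permutes {1..4 - 1}" using \<sigma> by simp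
    fix j :: nat assume "j \<in> {1..<4}"
    thus "k (\<sigma> j) = (\<Sum>l<j. [a, b, c] ! l)"
      unfolding residues_4 using k sums by auto
  qed
  moreover have "k ` {1..<4} = {a, a + b, a + b + c}"
    using permutes_3_cases[OF \<sigma>] k unfolding residues_4 by auto
  ultimately show ?thesis using sums by simp
qed

lemma gapset_filtration_4_iff:
  "gapset_filtration 4 F \<longleftrightarrow>
     (\<exists>\<sigma> a b c. F = perm_filtration 4 \<sigma> [a, b, c] \<and> \<sigma> permutes {1..3} \<and> a \<ge> 1 \<and>
        table_condition \<sigma> a b c)"
proof -
  have "(4::nat) \<ge> 2" by simp
  note kunz = gapset_filtration_iff_kunz[OF this, of F]
  show ?thesis
  proof
    assume "gapset_filtration 4 F"
    then obtain k where k: "\<forall>r\<in>{1..<4}. k r \<ge> 1" "kunz_inequalities 4 k"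
      and F: "F = map (superlevel 4 k) [0..<Max (k ` {1..<4})]"
      unfolding kunz by blast
    obtain \<sigma> where \<sigma>: "\<sigma> permutes {1..3}"
      and sorted: "\<forall>i j. 1 \<le> i \<and> i \<le> j \<and> j \<le> 3 \<longrightarrow> k (\<sigma> i) \<le> k (\<sigma> j)"
      using ex_sorting_permutation[of 3 k] by blast
    define a b c where "a = k (\<sigma> 1)" "b = k (\<sigma> 2) - k (\<sigma> 1)" "c = k (\<sigma> 3) - k (\<sigma> 2)"
    have "k (\<sigma> 1) \<le> k (\<sigma> 2)" "k (\<sigma> 2) \<le> k (\<sigma> 3)"
      using sorted by simp_all
    hence abc: "k (\<sigma> 1) = a" "k (\<sigma> 2) = a + b" "k (\<sigma> 3) = a + b + c"
      unfolding a_b_c_def by simp_all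
    have "a \<ge> 1"
    proof -
      have "\<sigma> 1 \<in> {1..<4}" using permutes_in_image[OF \<sigma>, of 1] by simp
      thus ?thesis using k(1) abc(1) by blast
    qed
    moreover have "table_condition \<sigma> a b c"
      using kunz_inequalities_4_iff_table[OF \<sigma> abc] k(2) by simp
    moreover have "F = perm_filtration 4 \<sigma> [a, b, c]"
      using perm_filtration_4_eq_superlevel[OF \<sigma> abc] F by simp
    ultimately show "\<exists>\<sigma> a b c. F = perm_filtration 4 \<sigma> [a, b, c] \<and> \<sigma> permutes {1..3} \<and> a \<ge> 1 \<and>
        table_condition \<sigma> a b c"
      using \<sigma> by blast
  next
    assume "\<exists>\<sigma> a b c. F = perm_filtration 4 \<sigma> [a, b, c] \<and> \<sigma> permutes {1..3} \<and> a \<ge> 1 \<and>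
        table_condition \<sigma> a b c"
    then obtain \<sigma> a b c where F: "F = perm_filtration 4 \<sigma> [a, b, c]" and \<sigma>: "\<sigma> permutes {1..3}"
      and a: "a \<ge> 1" and table: "table_condition \<sigma> a b c"
      by blast
    define k where "k r = (if r = \<sigma> 1 then a else if r = \<sigma> 2 then a + b else a + b + c)" for r
    have k: "k (\<sigma> 1) = a" "k (\<sigma> 2) = a + b" "k (\<sigma> 3) = a + b + c"
      using inj_eq[OF permutes_inj[OF \<sigma>]] by (auto simp: k_def)
    have "\<forall>r\<in>{1..<4}. k r \<ge> 1" using a by (auto simp: k_def)
    moreover have "kunz_inequalities 4 k"
      using kunz_inequalities_4_iff_table[OF \<sigma> k] table by simp
    ultimately show "gapset_filtration 4 F"
      unfolding kunz using perm_filtration_4_eq_superlevel[OF \<sigma> k] F by blast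
  qed
qed

lemma perm_filtration_4:
  assumes "\<sigma> permutes {1..3}"
  shows "perm_filtration 4 \<sigma> [a, b, c] =
    replicate a {1, 2, 3} @ replicate b ({1, 2, 3} - {\<sigma> 1}) @ replicate c {\<sigma> 3}"
proof -
  have "[0..<4 - 1] = [0, 1, 2::nat]" by (simp add: upt_rec numeral_eq_Suc)
  moreover have "chain_set 4 \<sigma> 0 = {1, 2, 3}" by auto
  moreover from this have "chain_set 4 \<sigma> 1 = {1, 2, 3} - {\<sigma> 1}" by simp
  moreover from this have "chain_set 4 \<sigma> 2 = {1, 2, 3} - {\<sigma> 1} - {\<sigma> 2}"
    by (simp add: numeral_2_eq_2)
  moreover have "{1, 2, 3} - {\<sigma> 1} - {\<sigma> 2} = {\<sigma> 3}"
    using permutes_3_cases[OF assms] by - (elim insertE emptyE; auto)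
  ultimately show ?thesis unfolding perm_filtration_def by simp
qed

theorem theorem5p1:
  shows "{F. gapset_filtration 4 F} =
         {perm_filtration 4 \<sigma> [a, b, c] | \<sigma> a b c.
           \<sigma> permutes {1..3} \<and> a \<ge> 1 \<and>
           (window 3 \<sigma> = [1, 2, 3] \<and> b \<le> a \<and> c \<le> a \<or>
            window 3 \<sigma> = [1, 3, 2] \<and> b + c \<le> a \<or>
            window 3 \<sigma> = [2, 1, 3] \<and> c \<le> a \<or>
            window 3 \<sigma> = [2, 3, 1] \<and> c \<le> a + 1 \<or>
            window 3 \<sigma> = [3, 1, 2] \<and> b + c \<le> a + 1 \<and> c \<le> a + b \<or>
            window 3 \<sigma> = [3, 2, 1] \<and> b \<le> a + 1 \<and> c \<le> a + 1)} \<and>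
         (\<forall>\<sigma> a b c. \<sigma> permutes {1..3} \<and> a \<ge> 1 \<longrightarrow>
          (window 3 \<sigma> = [1, 2, 3] \<longrightarrow> perm_filtration 4 \<sigma> [a, b, c] =
             replicate a {1, 2, 3} @ replicate b {2, 3} @ replicate c {3}) \<and>
          (window 3 \<sigma> = [1, 3, 2] \<longrightarrow> perm_filtration 4 \<sigma> [a, b, c] =
             replicate a {1, 2, 3} @ replicate b {2, 3} @ replicate c {2}) \<and>
          (window 3 \<sigma> = [2, 1, 3] \<longrightarrow> perm_filtration 4 \<sigma> [a, b, c] =
             replicate a {1, 2, 3} @ replicate b {1, 3} @ replicate c {3}) \<and>
          (window 3 \<sigma> = [2, 3, 1] \<longrightarrow> perm_filtration 4 \<sigma> [a, b, c] =
             replicate a {1, 2, 3} @ replicate b {1, 3} @ replicate c {1}) \<and>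
          (window 3 \<sigma> = [3, 1, 2] \<longrightarrow> perm_filtration 4 \<sigma> [a, b, c] =
             replicate a {1, 2, 3} @ replicate b {1, 2} @ replicate c {2}) \<and>
          (window 3 \<sigma> = [3, 2, 1] \<longrightarrow> perm_filtration 4 \<sigma> [a, b, c] =
             replicate a {1, 2, 3} @ replicate b {1, 2} @ replicate c {1}))"
proof (intro conjI allI impI, goal_cases)
  case 1
  show ?case unfolding gapset_filtration_4_iff table_condition_def by (rule refl)
qed (simp_all add: perm_filtration_4 window_3 insert_Diff_if)

end
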